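(* Let $R$ be a (not necessarily commutative) ring with identity, let $\mathcal{M}_R$ be the category of right $R$-modules, let $I$ be a set, and let $\mathcal{M}_R^I$ be the direct product category of $I$ copies of $\mathcal{M}_R$. The functors $\prod_{i\in I}$ and $\bigoplus_{i\in I}$ from $\mathcal{M}_R^I$ to $\mathcal{M}_R$ (the product and coproduct of modules) are naturally isomorphic if and only if $I$ is a finite set.
   Context: The objects of $\mathcal{M}_R^I$ are families $(M_i)_{i\in I}$ of right $R$-modules and its morphisms are families $(f_i)_{i\in I}$ of $R$-linear maps. The functors send $(M_i)_{i\in I}$ to the product $\prod_{i\in I}M_i$ and to the direct sum $\bigoplus_{i\in I}M_i$ respectively, with the evident action on morphisms.
   Formalization: The ring R is assumed to be nonzero (1 ≠ 0): over the zero ring every module is zero, so the product and direct sum functors are naturally isomorphic even when I is infinite. *)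

theory Defs
  imports "HOL-Algebra.Product_Groups" "HOL-Algebra.Module"
begin

section \<open>Categories, functors and natural isomorphisms\<close>

text \<open>
  Composition takes the three objects involved as explicit arguments:
  \<open>Comp C X Y Z g f\<close> is the composite of \<open>f : X \<rightarrow> Y\<close> followed by \<open>g : Y \<rightarrow> Z\<close>.
  Hom-sets of distinct pairs of objects need not be disjoint.
\<close>

record ('o, 'a) category =
  Ob :: "'o set"
  Hom :: "'o \<Rightarrow> 'o \<Rightarrow> 'a set"
  Ident :: "'o \<Rightarrow> 'a"
  Comp :: "'o \<Rightarrow> 'o \<Rightarrow> 'o \<Rightarrow> 'a \<Rightarrow> 'a \<Rightarrow> 'a"

locale category =
  fixes C :: "('o, 'a) category"
  assumes ident_hom: "X \<in> Ob C \<Longrightarrow> Ident C X \<in> Hom C X X"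
    and comp_hom: "\<lbrakk>X \<in> Ob C; Y \<in> Ob C; Z \<in> Ob C; f \<in> Hom C X Y; g \<in> Hom C Y Z\<rbrakk>
      \<Longrightarrow> Comp C X Y Z g f \<in> Hom C X Z"
    and comp_ident_right: "\<lbrakk>X \<in> Ob C; Y \<in> Ob C; f \<in> Hom C X Y\<rbrakk>
      \<Longrightarrow> Comp C X X Y f (Ident C X) = f"
    and comp_ident_left: "\<lbrakk>X \<in> Ob C; Y \<in> Ob C; f \<in> Hom C X Y\<rbrakk>
      \<Longrightarrow> Comp C X Y Y (Ident C Y) f = f"
    and comp_assoc: "\<lbrakk>W \<in> Ob C; X \<in> Ob C; Y \<in> Ob C; Z \<in> Ob C;
        f \<in> Hom C W X; g \<in> Hom C X Y; h \<in> Hom C Y Z\<rbrakk>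
      \<Longrightarrow> Comp C W X Z (Comp C X Y Z h g) f = Comp C W Y Z h (Comp C W X Y g f)"

definition isomorphism :: "('o, 'a) category \<Rightarrow> 'o \<Rightarrow> 'o \<Rightarrow> 'a \<Rightarrow> bool" where
  "isomorphism C X Y f \<longleftrightarrow> f \<in> Hom C X Y \<and>
     (\<exists>g \<in> Hom C Y X. Comp C X Y X g f = Ident C X \<and> Comp C Y X Y f g = Ident C Y)"

record ('o1, 'a1, 'o2, 'a2) functor_map =
  ob_map :: "'o1 \<Rightarrow> 'o2"
  arr_map :: "'o1 \<Rightarrow> 'o1 \<Rightarrow> 'a1 \<Rightarrow> 'a2"

locale category_functor = dom: category C + cod: category D
  for C :: "('o1, 'a1) category" and D :: "('o2, 'a2) category" +
  fixes F :: "('o1, 'a1, 'o2, 'a2) functor_map"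
  assumes ob_map_closed: "X \<in> Ob C \<Longrightarrow> ob_map F X \<in> Ob D"
    and arr_map_closed: "\<lbrakk>X \<in> Ob C; Y \<in> Ob C; f \<in> Hom C X Y\<rbrakk>
      \<Longrightarrow> arr_map F X Y f \<in> Hom D (ob_map F X) (ob_map F Y)"
    and arr_map_ident: "X \<in> Ob C \<Longrightarrow> arr_map F X X (Ident C X) = Ident D (ob_map F X)"
    and arr_map_comp: "\<lbrakk>X \<in> Ob C; Y \<in> Ob C; Z \<in> Ob C; f \<in> Hom C X Y; g \<in> Hom C Y Z\<rbrakk>
      \<Longrightarrow> arr_map F X Z (Comp C X Y Z g f) =
          Comp D (ob_map F X) (ob_map F Y) (ob_map F Z) (arr_map F Y Z g) (arr_map F X Y f)"

locale natural_transformation = F: category_functor C D F + G: category_functor C D G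
  for C :: "('o1, 'a1) category" and D :: "('o2, 'a2) category"
    and F :: "('o1, 'a1, 'o2, 'a2) functor_map"
    and G :: "('o1, 'a1, 'o2, 'a2) functor_map" +
  fixes \<eta> :: "'o1 \<Rightarrow> 'a2"
  assumes component_hom: "X \<in> Ob C \<Longrightarrow> \<eta> X \<in> Hom D (ob_map F X) (ob_map G X)"
    and naturality: "\<lbrakk>X \<in> Ob C; Y \<in> Ob C; f \<in> Hom C X Y\<rbrakk>
      \<Longrightarrow> Comp D (ob_map F X) (ob_map G X) (ob_map G Y) (arr_map G X Y f) (\<eta> X) =
          Comp D (ob_map F X) (ob_map F Y) (ob_map G Y) (\<eta> Y) (arr_map F X Y f)"

definition naturally_isomorphic ::
  "('o1, 'a1) category \<Rightarrow> ('o2, 'a2) category \<Rightarrow>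
   ('o1, 'a1, 'o2, 'a2) functor_map \<Rightarrow> ('o1, 'a1, 'o2, 'a2) functor_map \<Rightarrow> bool" where
  "naturally_isomorphic C D F G \<longleftrightarrow>
     (\<exists>\<eta>. natural_transformation C D F G \<eta> \<and>
          (\<forall>X \<in> Ob C. isomorphism D (ob_map F X) (ob_map G X) (\<eta> X)))"

text \<open>
  The direct product category of copies of \<open>C\<close> indexed by \<open>I\<close>. Families are extensional,
  so that two families agreeing on \<open>I\<close> are equal.
\<close>

definition power_category ::
  "'i set \<Rightarrow> ('o, 'a) category \<Rightarrow> ('i \<Rightarrow> 'o, 'i \<Rightarrow> 'a) category" where
  "power_category I C = \<lparr>
     Ob = (\<Pi>\<^sub>E i\<in>I. Ob C),
     Hom = (\<lambda>X Y. \<Pi>\<^sub>E i\<in>I. Hom C (X i) (Y i)),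
     Ident = (\<lambda>X. \<lambda>i\<in>I. Ident C (X i)),
     Comp = (\<lambda>X Y Z g f. \<lambda>i\<in>I. Comp C (X i) (Y i) (Z i) (g i) (f i))\<rparr>"

section \<open>Right modules over a ring\<close>

text \<open>
  The locale \<^locale>\<open>module\<close> of HOL-Algebra only covers left modules over commutative rings.
  A right module is here an abelian group, written multiplicatively as in
  \<^locale>\<open>comm_group\<close> so that \<open>\<otimes>\<^bsub>M\<^esub>\<close> and \<open>\<one>\<^bsub>M\<^esub>\<close> are the addition and the zero
  of the module, together with an action: \<open>act M x r\<close> stands for \<open>x r\<close>.
\<close>

record ('m, 'r) right_module = "'m monoid" +
  act :: "'m \<Rightarrow> 'r \<Rightarrow> 'm"

locale right_module = R: ring R + M: comm_group M
  for R :: "('r, 'b) ring_scheme" and M :: "('m, 'r) right_module" +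
  assumes act_closed: "\<lbrakk>x \<in> carrier M; r \<in> carrier R\<rbrakk> \<Longrightarrow> act M x r \<in> carrier M"
    and act_add_left: "\<lbrakk>x \<in> carrier M; y \<in> carrier M; r \<in> carrier R\<rbrakk>
      \<Longrightarrow> act M (x \<otimes>\<^bsub>M\<^esub> y) r = act M x r \<otimes>\<^bsub>M\<^esub> act M y r"
    and act_add_right: "\<lbrakk>x \<in> carrier M; r \<in> carrier R; s \<in> carrier R\<rbrakk>
      \<Longrightarrow> act M x (r \<oplus>\<^bsub>R\<^esub> s) = act M x r \<otimes>\<^bsub>M\<^esub> act M x s"
    and act_mult: "\<lbrakk>x \<in> carrier M; r \<in> carrier R; s \<in> carrier R\<rbrakk>
      \<Longrightarrow> act M x (r \<otimes>\<^bsub>R\<^esub> s) = act M (act M x r) s"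
    and act_one: "x \<in> carrier M \<Longrightarrow> act M x \<one>\<^bsub>R\<^esub> = x"

definition linear_maps ::
  "('r, 'b) ring_scheme \<Rightarrow> ('m, 'r) right_module \<Rightarrow> ('n, 'r) right_module \<Rightarrow> ('m \<Rightarrow> 'n) set" where
  "linear_maps R M N =
     {f \<in> hom M N \<inter> extensional (carrier M).
        \<forall>x \<in> carrier M. \<forall>r \<in> carrier R. f (act M x r) = act N (f x) r}"

text \<open>
  The category of right \<open>R\<close>-modules whose underlying set is a set of elements of type \<open>'m\<close>;
  the type \<open>'m\<close> plays the role of the universe.
\<close>

definition right_modules ::
  "('r, 'b) ring_scheme \<Rightarrow> (('m, 'r) right_module, 'm \<Rightarrow> 'm) category" where
  "right_modules R = \<lparr>
     Ob = {M. right_module R M},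
     Hom = linear_maps R,
     Ident = (\<lambda>M. \<lambda>x\<in>carrier M. x),
     Comp = (\<lambda>L M N g f. compose (carrier L) g f)\<rparr>"

section \<open>Products and direct sums\<close>

definition product_module ::
  "'i set \<Rightarrow> ('i \<Rightarrow> ('m, 'r) right_module) \<Rightarrow> ('i \<Rightarrow> 'm, 'r) right_module" where
  "product_module I M = \<lparr>
     carrier = carrier (product_group I M),
     mult = mult (product_group I M),
     one = one (product_group I M),
     act = (\<lambda>x r. \<lambda>i\<in>I. act (M i) (x i) r)\<rparr>"

definition direct_sum_module ::
  "'i set \<Rightarrow> ('i \<Rightarrow> ('m, 'r) right_module) \<Rightarrow> ('i \<Rightarrow> 'm, 'r) right_module" where
  "direct_sum_module I M = \<lparr>
     carrier = carrier (sum_group I M),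
     mult = mult (sum_group I M),
     one = one (sum_group I M),
     act = (\<lambda>x r. \<lambda>i\<in>I. act (M i) (x i) r)\<rparr>"

lemma carrier_direct_sum_module:
  assumes "\<And>i. i \<in> I \<Longrightarrow> group (M i)"
  shows "carrier (direct_sum_module I M) =
    {x \<in> \<Pi>\<^sub>E i\<in>I. carrier (M i). finite {i \<in> I. x i \<noteq> \<one>\<^bsub>M i\<^esub>}}"
  using assms by (simp add: direct_sum_module_def carrier_sum_group)

definition product_functor ::
  "'i set \<Rightarrow> ('i \<Rightarrow> ('m, 'r) right_module, 'i \<Rightarrow> 'm \<Rightarrow> 'm,
              ('i \<Rightarrow> 'm, 'r) right_module, ('i \<Rightarrow> 'm) \<Rightarrow> ('i \<Rightarrow> 'm)) functor_map" where
  "product_functor I = \<lparr>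
     ob_map = product_module I,
     arr_map = (\<lambda>M N f. \<lambda>x\<in>carrier (product_module I M). \<lambda>i\<in>I. f i (x i))\<rparr>"

definition direct_sum_functor ::
  "'i set \<Rightarrow> ('i \<Rightarrow> ('m, 'r) right_module, 'i \<Rightarrow> 'm \<Rightarrow> 'm,
              ('i \<Rightarrow> 'm, 'r) right_module, ('i \<Rightarrow> 'm) \<Rightarrow> ('i \<Rightarrow> 'm)) functor_map" where
  "direct_sum_functor I = \<lparr>
     ob_map = direct_sum_module I,
     arr_map = (\<lambda>M N f. \<lambda>x\<in>carrier (direct_sum_module I M). \<lambda>i\<in>I. f i (x i))\<rparr>"

end

theory Submission
  imports Defs
begin

text \<open>
  The two functors differ only in the finiteness condition on supports, so over a finite index
  set they coincide on families of modules (\<open>direct_sum_module_eq_product_module\<close>) and the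
  identities form a natural isomorphism.

  Conversely, let \<open>\<eta>\<close> be a natural transformation from the product to the direct sum all of
  whose components are injective. For \<open>j \<in> I\<close>, every family \<open>M\<close> has an idempotent endomorphism
  \<open>e\<^sub>j\<close> that is the identity at \<open>j\<close> and zero elsewhere, and both functors send it to the
  operation that erases all coordinates but the \<open>j\<close>-th. Naturality therefore reads
  \<open>\<eta> (e\<^sub>j x) = e\<^sub>j (\<eta> x)\<close>. If the \<open>j\<close>-th coordinate of \<open>\<eta> x\<close> vanishes, the right-hand side is
  zero, hence \<open>e\<^sub>j x\<close> is zero by injectivity, and so is \<open>x j\<close>. Thus \<open>\<eta>\<close> cannot shrink supports
  (\<open>natural_mono_preserves_support\<close>). Applied to the constant family with value \<open>R\<close> and to the
  element all of whose coordinates are \<open>1\<close>, this produces an element of the direct sum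
  with support \<open>I\<close>, so \<open>I\<close> is finite.
\<close>

section \<open>Functors that agree on objects and arrows\<close>

lemma isomorphism_Ident:
  assumes "category C" "X \<in> Ob C"
  shows "isomorphism C X X (Ident C X)"
  using assms
  by (auto simp: isomorphism_def category.ident_hom category.comp_ident_left
      intro!: bexI[of _ "Ident C X"])

text \<open>
  Functors are given by total functions, so two functors with the same values on the objects and
  arrows of the source category need not be equal as records; they are still isomorphic via
  identities.
\<close>

lemma naturally_isomorphic_if_agree:
  assumes F: "category_functor C D F"
    and ob: "\<And>X. X \<in> Ob C \<Longrightarrow> ob_map G X = ob_map F X"
    and arr: "\<And>X Y f. \<lbrakk>X \<in> Ob C; Y \<in> Ob C; f \<in> Hom C X Y\<rbrakk>
      \<Longrightarrow> arr_map G X Y f = arr_map F X Y f"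
  shows "naturally_isomorphic C D F G"
proof -
  interpret F: category_functor C D F by (rule F)
  interpret G: category_functor C D G
    by unfold_locales
      (simp_all add: ob arr F.ob_map_closed F.arr_map_closed F.arr_map_ident F.arr_map_comp
        F.dom.ident_hom F.dom.comp_hom)
  have "natural_transformation C D F G (\<lambda>X. Ident D (ob_map F X))"
    by unfold_locales
      (simp_all add: ob arr F.ob_map_closed F.cod.ident_hom
        F.cod.comp_ident_left[OF _ _ F.arr_map_closed]
        F.cod.comp_ident_right[OF _ _ F.arr_map_closed])
  moreover have "isomorphism D (ob_map F X) (ob_map G X) (Ident D (ob_map F X))"
    if "X \<in> Ob C" for X
    using that by (simp add: ob isomorphism_Ident F.cod.category_axioms F.ob_map_closed)
  ultimately show ?thesis
    unfolding naturally_isomorphic_def by blast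
qed

section \<open>The category of right modules and its powers\<close>

lemma linear_mapsI:
  assumes "f \<in> extensional (carrier M)"
    and "\<And>x. x \<in> carrier M \<Longrightarrow> f x \<in> carrier N"
    and "\<And>x y. \<lbrakk>x \<in> carrier M; y \<in> carrier M\<rbrakk> \<Longrightarrow> f (x \<otimes>\<^bsub>M\<^esub> y) = f x \<otimes>\<^bsub>N\<^esub> f y"
    and "\<And>x r. \<lbrakk>x \<in> carrier M; r \<in> carrier R\<rbrakk> \<Longrightarrow> f (act M x r) = act N (f x) r"
  shows "f \<in> linear_maps R M N"
  using assms by (auto simp: linear_maps_def hom_def)

lemma linear_mapsD:
  assumes "f \<in> linear_maps R M N"
  shows "f \<in> extensional (carrier M)"
    and "x \<in> carrier M \<Longrightarrow> f x \<in> carrier N"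
    and "\<lbrakk>x \<in> carrier M; y \<in> carrier M\<rbrakk> \<Longrightarrow> f (x \<otimes>\<^bsub>M\<^esub> y) = f x \<otimes>\<^bsub>N\<^esub> f y"
    and "\<lbrakk>x \<in> carrier M; r \<in> carrier R\<rbrakk> \<Longrightarrow> f (act M x r) = act N (f x) r"
  using assms by (auto simp: linear_maps_def hom_def)

lemma right_modules_simps [simp]:
  "Ob (right_modules R) = {M. right_module R M}"
  "Hom (right_modules R) = linear_maps R"
  "Ident (right_modules R) M = (\<lambda>x\<in>carrier M. x)"
  "Comp (right_modules R) L M N g f = compose (carrier L) g f"
  by (simp_all add: right_modules_def)

lemma power_category_simps [simp]:
  "Ob (power_category I C) = (\<Pi>\<^sub>E i\<in>I. Ob C)"
  "Hom (power_category I C) X Y = (\<Pi>\<^sub>E i\<in>I. Hom C (X i) (Y i))"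
  "Ident (power_category I C) X = (\<lambda>i\<in>I. Ident C (X i))"
  "Comp (power_category I C) X Y Z g f = (\<lambda>i\<in>I. Comp C (X i) (Y i) (Z i) (g i) (f i))"
  by (simp_all add: power_category_def)

lemma right_module_closed:
  assumes "right_module R M"
  shows "\<lbrakk>x \<in> carrier M; y \<in> carrier M\<rbrakk> \<Longrightarrow> x \<otimes>\<^bsub>M\<^esub> y \<in> carrier M"
    and "\<one>\<^bsub>M\<^esub> \<in> carrier M"
    and "\<lbrakk>x \<in> carrier M; r \<in> carrier R\<rbrakk> \<Longrightarrow> act M x r \<in> carrier M"
proof -
  interpret right_module R M by (rule assms)
  show "\<lbrakk>x \<in> carrier M; y \<in> carrier M\<rbrakk> \<Longrightarrow> x \<otimes>\<^bsub>M\<^esub> y \<in> carrier M"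
    and "\<one>\<^bsub>M\<^esub> \<in> carrier M"
    and "\<lbrakk>x \<in> carrier M; r \<in> carrier R\<rbrakk> \<Longrightarrow> act M x r \<in> carrier M"
    by (simp_all add: act_closed)
qed

lemma right_module_group: "right_module R M \<Longrightarrow> group M"
  by (simp add: right_module_def comm_group.axioms)

lemma right_module_act_zero:
  assumes "right_module R M" "r \<in> carrier R"
  shows "act M \<one>\<^bsub>M\<^esub> r = \<one>\<^bsub>M\<^esub>"
proof -
  interpret right_module R M by (rule assms)
  have "act M \<one>\<^bsub>M\<^esub> r \<otimes>\<^bsub>M\<^esub> act M \<one>\<^bsub>M\<^esub> r = act M \<one>\<^bsub>M\<^esub> r"
    using act_add_left[of "\<one>\<^bsub>M\<^esub>" "\<one>\<^bsub>M\<^esub>" r] assms(2) by simp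
  then show ?thesis
    using assms(2) by (simp add: act_closed M.l_cancel_one')
qed

lemma category_right_modules:
  fixes R :: "('r, 'b) ring_scheme"
  shows "category (right_modules R :: (('m, 'r) right_module, 'm \<Rightarrow> 'm) category)"
proof
  fix X :: "('m, 'r) right_module"
  assume X: "X \<in> Ob (right_modules R)"
  then show "Ident (right_modules R) X \<in> Hom (right_modules R) X X"
    by (auto intro!: linear_mapsI simp: right_module_closed)
next
  fix X Y Z :: "('m, 'r) right_module" and f g
  assume "X \<in> Ob (right_modules R)" and f: "f \<in> Hom (right_modules R) X Y"
    and g: "g \<in> Hom (right_modules R) Y Z"
  then have X: "right_module R X"
    and f': "f \<in> linear_maps R X Y" and g': "g \<in> linear_maps R Y Z"
    by simp_all
  have "compose (carrier X) g f \<in> linear_maps R X Z"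
    by (rule linear_mapsI)
      (simp_all add: compose_def right_module_closed[OF X] linear_mapsD[OF f'] linear_mapsD[OF g'])
  then show "Comp (right_modules R) X Y Z g f \<in> Hom (right_modules R) X Z"
    by simp
next
  fix X Y :: "('m, 'r) right_module" and f
  assume "f \<in> Hom (right_modules R) X Y"
  then have f: "f \<in> linear_maps R X Y" by simp
  show "Comp (right_modules R) X X Y f (Ident (right_modules R) X) = f"
    using linear_mapsD(1)[OF f] by (auto simp: compose_def extensional_def fun_eq_iff)
  show "Comp (right_modules R) X Y Y (Ident (right_modules R) Y) f = f"
    using linear_mapsD(1,2)[OF f] by (auto simp: compose_def extensional_def fun_eq_iff)
next
  fix W X Y Z :: "('m, 'r) right_module" and f g h
  assume "f \<in> Hom (right_modules R) W X"
  then show "Comp (right_modules R) W X Z (Comp (right_modules R) X Y Z h g) f =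
      Comp (right_modules R) W Y Z h (Comp (right_modules R) W X Y g f)"
    by (auto simp: compose_def fun_eq_iff linear_mapsD)
qed

lemma category_power_category:
  assumes "category C"
  shows "category (power_category I C)"
proof -
  interpret category C by (rule assms)
  show ?thesis
  proof
    fix X Y and f :: "'c \<Rightarrow> 'b"
    assume XY: "X \<in> Ob (power_category I C)" "Y \<in> Ob (power_category I C)"
      and f: "f \<in> Hom (power_category I C) X Y"
    show "Comp (power_category I C) X X Y f (Ident (power_category I C) X) = f"
    proof
      fix i
      show "Comp (power_category I C) X X Y f (Ident (power_category I C) X) i = f i"
        using XY f comp_ident_right[of "X i" "Y i" "f i"]
        by (cases "i \<in> I") (auto simp: PiE_iff extensional_def)
    qed
    show "Comp (power_category I C) X Y Y (Ident (power_category I C) Y) f = f"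
    proof
      fix i
      show "Comp (power_category I C) X Y Y (Ident (power_category I C) Y) f i = f i"
        using XY f comp_ident_left[of "X i" "Y i" "f i"]
        by (cases "i \<in> I") (auto simp: PiE_iff extensional_def)
    qed
  qed (auto simp: PiE_iff fun_eq_iff comp_assoc intro!: ident_hom intro: comp_hom)
qed

section \<open>Products and finite direct sums of modules\<close>

lemma product_module_simps [simp]:
  "carrier (product_module I M) = (\<Pi>\<^sub>E i\<in>I. carrier (M i))"
  "x \<otimes>\<^bsub>product_module I M\<^esub> y = (\<lambda>i\<in>I. x i \<otimes>\<^bsub>M i\<^esub> y i)"
  "\<one>\<^bsub>product_module I M\<^esub> = (\<lambda>i\<in>I. \<one>\<^bsub>M i\<^esub>)"
  "act (product_module I M) x r = (\<lambda>i\<in>I. act (M i) (x i) r)"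
  by (simp_all add: product_module_def)

lemma right_module_product_module:
  assumes R: "ring R" and M: "\<And>i. i \<in> I \<Longrightarrow> right_module R (M i)"
  shows "right_module R (product_module I M)"
proof -
  have group: "group (product_group I M)"
    by (intro product_group right_module_group[OF M])
  have comm: "comm_group (product_module I M)"
  proof (rule group.group_comm_groupI)
    show "group (product_module I M)"
      using group unfolding group_def group_axioms_def monoid_def Units_def product_module_def
      by simp
    show "x \<otimes>\<^bsub>product_module I M\<^esub> y = y \<otimes>\<^bsub>product_module I M\<^esub> x"
      if "x \<in> carrier (product_module I M)" "y \<in> carrier (product_module I M)" for x y
      using that M
      by (auto simp: PiE_iff fun_eq_iff right_module_def comm_group_def
          intro!: comm_monoid.m_comm)
  qed
  show ?thesis
    by (intro right_module.intro right_module_axioms.intro R comm)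
      (auto simp: PiE_iff extensional_def fun_eq_iff
        right_module.act_closed[OF M] right_module.act_add_left[OF M]
        right_module.act_add_right[OF M] right_module.act_mult[OF M] right_module.act_one[OF M])
qed

lemma direct_sum_module_eq_product_module:
  assumes "finite I" and "\<And>i. i \<in> I \<Longrightarrow> group (M i)"
  shows "direct_sum_module I M = product_module I M"
proof -
  have "carrier (sum_group I M) = carrier (product_group I M)"
    using assms by (auto simp: carrier_sum_group)
  then show ?thesis
    by (simp add: direct_sum_module_def product_module_def)
qed

lemma product_functor_simps [simp]:
  "ob_map (product_functor I) = product_module I"
  "arr_map (product_functor I) M N f = (\<lambda>x\<in>(\<Pi>\<^sub>E i\<in>I. carrier (M i)). \<lambda>i\<in>I. f i (x i))"
  by (simp_all add: product_functor_def)

lemma direct_sum_functor_simps [simp]: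
  "ob_map (direct_sum_functor I) = direct_sum_module I"
  "arr_map (direct_sum_functor I) M N f =
    (\<lambda>x\<in>carrier (direct_sum_module I M). \<lambda>i\<in>I. f i (x i))"
  by (simp_all add: direct_sum_functor_def)

lemma category_functor_product_functor:
  fixes R :: "('r, 'b) ring_scheme" and I :: "'i set"
  assumes R: "ring R"
  shows "category_functor
    (power_category I (right_modules R :: (('m, 'r) right_module, 'm \<Rightarrow> 'm) category))
    (right_modules R) (product_functor I)"
proof -
  let ?C = "power_category I (right_modules R :: (('m, 'r) right_module, 'm \<Rightarrow> 'm) category)"
  interpret C: category ?C
    by (intro category_power_category category_right_modules)
  interpret D: category "right_modules R :: (('i \<Rightarrow> 'm, 'r) right_module, _) category"
    by (rule category_right_modules)
  show ?thesis
  proof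
    fix M assume "M \<in> Ob ?C"
    then show "ob_map (product_functor I) M \<in> Ob (right_modules R)"
      by (auto intro!: right_module_product_module R)
  next
    fix M N f
    assume "M \<in> Ob ?C" "f \<in> Hom ?C M N"
    then have M: "right_module R (M i)" and f: "f i \<in> linear_maps R (M i) (N i)"
      if "i \<in> I" for i
      using that by auto
    have "arr_map (product_functor I) M N f
        \<in> linear_maps R (product_module I M) (product_module I N)"
      by (rule linear_mapsI)
        (auto simp: PiE_iff fun_eq_iff right_module_closed[OF M] linear_mapsD[OF f])
    then show "arr_map (product_functor I) M N f
        \<in> Hom (right_modules R) (ob_map (product_functor I) M) (ob_map (product_functor I) N)"
      by simp
  next
    fix M assume "M \<in> Ob ?C"
    show "arr_map (product_functor I) M M (Ident ?C M)
        = Ident (right_modules R) (ob_map (product_functor I) M)"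
      by (auto simp: PiE_iff extensional_def fun_eq_iff)
  next
    fix L M N f g
    assume "f \<in> Hom ?C L M"
    then have f: "f i \<in> linear_maps R (L i) (M i)" if "i \<in> I" for i
      using that by auto
    show "arr_map (product_functor I) L N (Comp ?C L M N g f) =
      Comp (right_modules R) (ob_map (product_functor I) L) (ob_map (product_functor I) M)
        (ob_map (product_functor I) N)
        (arr_map (product_functor I) M N g) (arr_map (product_functor I) L M f)"
      by (auto simp: PiE_iff compose_def fun_eq_iff linear_mapsD[OF f])
  qed
qed

lemma naturally_isomorphic_product_direct_sum_if_finite:
  fixes R :: "('r, 'b) ring_scheme" and I :: "'i set"
  assumes "ring R" and I: "finite I"
  shows "naturally_isomorphic
    (power_category I (right_modules R :: (('m, 'r) right_module, 'm \<Rightarrow> 'm) category))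
    (right_modules R) (product_functor I) (direct_sum_functor I)"
proof -
  have eq: "direct_sum_module I M = product_module I M"
    if "M \<in> Ob (power_category I (right_modules R))" for M :: "'i \<Rightarrow> ('m, 'r) right_module"
    using that
    by (intro direct_sum_module_eq_product_module I) (auto intro: right_module_group)
  show ?thesis
    by (rule naturally_isomorphic_if_agree[OF category_functor_product_functor])
      (simp_all only: assms eq direct_sum_functor_simps product_functor_simps
        product_module_simps)
qed

section \<open>Natural monomorphisms from the product preserve supports\<close>

text \<open>
  The endomorphism \<open>e\<^sub>j\<close> of the family \<open>M\<close>. Both restrictions are needed to obtain an arrow:
  arrows of a power category are extensional on the index set, linear maps on the carrier.
\<close>

definition coordinate_idempotent ::
  "'i set \<Rightarrow> ('i \<Rightarrow> ('m, 'r) right_module) \<Rightarrow> 'i \<Rightarrow> 'i \<Rightarrow> 'm \<Rightarrow> 'm" where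
  "coordinate_idempotent I M j =
    (\<lambda>i\<in>I. \<lambda>x\<in>carrier (M i). if i = j then x else \<one>\<^bsub>M i\<^esub>)"

lemma coordinate_idempotent_hom:
  assumes "\<And>i. i \<in> I \<Longrightarrow> right_module R (M i)"
  shows "coordinate_idempotent I M j \<in> Hom (power_category I (right_modules R)) M M"
proof -
  have "(\<lambda>x\<in>carrier (M i). if i = j then x else \<one>\<^bsub>M i\<^esub>) \<in> linear_maps R (M i) (M i)"
    if "i \<in> I" for i
  proof -
    interpret right_module R "M i" by (rule assms[OF that])
    show ?thesis
      by (rule linear_mapsI)
        (auto simp: act_closed right_module_act_zero[OF assms[OF that]])
  qed
  then show ?thesis
    by (auto simp: coordinate_idempotent_def)
qed

text \<open>
  Naturality with respect to \<open>e\<^sub>j\<close> makes the \<open>j\<close>-th coordinate of \<open>\<eta> x\<close> control \<open>\<eta> (e\<^sub>j x)\<close>,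
  and injectivity then makes it control \<open>e\<^sub>j x\<close>, that is \<open>x j\<close>.
\<close>

lemma natural_mono_preserves_support:
  fixes R :: "('r, 'b) ring_scheme" and M :: "'i \<Rightarrow> ('m, 'r) right_module"
  assumes nat: "natural_transformation (power_category I (right_modules R)) (right_modules R)
      (product_functor I) (direct_sum_functor I) \<eta>"
    and M: "M \<in> Ob (power_category I (right_modules R))"
    and inj: "inj_on (\<eta> M) (carrier (product_module I M))"
    and x: "x \<in> carrier (product_module I M)"
    and j: "j \<in> I" "x j \<noteq> \<one>\<^bsub>M j\<^esub>"
  shows "\<eta> M x j \<noteq> \<one>\<^bsub>M j\<^esub>"
proof
  interpret natural_transformation "power_category I (right_modules R)" "right_modules R"
    "product_functor I" "direct_sum_functor I" \<eta>
    by (rule nat)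
  assume vanish: "\<eta> M x j = \<one>\<^bsub>M j\<^esub>"
  have mod: "right_module R (M i)" if "i \<in> I" for i
    using M that by auto
  let ?P = "product_module I M" and ?S = "direct_sum_module I M"
  let ?e = "coordinate_idempotent I M j"
  let ?ex = "\<lambda>i\<in>I. ?e i (x i)"
  have \<eta>: "\<eta> M \<in> linear_maps R ?P ?S"
    using component_hom[OF M] by simp
  have S: "carrier ?S \<subseteq> (\<Pi>\<^sub>E i\<in>I. carrier (M i))"
    using carrier_direct_sum_module[of I M] right_module_group[OF mod] by auto
  have \<eta>x: "\<eta> M x \<in> carrier ?S"
    using linear_mapsD(2)[OF \<eta> x] .
  have ex: "?ex \<in> carrier ?P"
    using x right_module_closed(2)[OF mod] by (auto simp: coordinate_idempotent_def PiE_iff)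
  have one: "\<one>\<^bsub>?P\<^esub> \<in> carrier ?P"
    using right_module_closed(2)[OF mod] by auto
  have "\<eta> M ?ex = (\<lambda>i\<in>I. ?e i (\<eta> M x i))"
    using fun_cong[OF naturality[OF M M coordinate_idempotent_hom[where I = I and j = j, OF mod]], of x] x \<eta>x
    by (simp add: compose_def)
  also have "\<dots> = \<one>\<^bsub>?P\<^esub>"
    using S \<eta>x vanish by (force simp: coordinate_idempotent_def fun_eq_iff PiE_iff)
  also have "\<dots> = \<eta> M \<one>\<^bsub>?P\<^esub>"
  proof -
    have "group_hom ?P ?S (\<eta> M)"
      using F.ob_map_closed[OF M] G.ob_map_closed[OF M] \<eta>
      by (auto simp: group_hom_def group_hom_axioms_def right_module_group linear_maps_def)
    then have "\<eta> M \<one>\<^bsub>?P\<^esub> = \<one>\<^bsub>?S\<^esub>"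
      by (rule group_hom.hom_one)
    then show ?thesis
      by (simp add: direct_sum_module_def)
  qed
  finally have "?ex = \<one>\<^bsub>?P\<^esub>"
    using inj ex one by (simp only: inj_on_eq_iff)
  then have "?ex j = \<one>\<^bsub>M j\<^esub>"
    using j(1) by simp
  then show False
    using j x PiE_mem[of x I "\<lambda>i. carrier (M i)" j] by (simp add: coordinate_idempotent_def)
qed

lemma isomorphism_right_modules_inj_on:
  assumes "isomorphism (right_modules R) M N f"
  shows "inj_on f (carrier M)"
proof -
  obtain g where "compose (carrier M) g f = (\<lambda>x\<in>carrier M. x)"
    using assms by (auto simp: isomorphism_def)
  then have "g (f x) = x" if "x \<in> carrier M" for x
    using that by (metis compose_eq restrict_apply')
  then show ?thesis
    by (rule inj_on_inverseI)
qed

section \<open>The regular module\<close>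

text \<open>
  The ring as a right module over itself, transported along \<open>h\<close> because the elements of its
  carrier need not belong to the type chosen as the universe of modules.
\<close>

definition regular_module ::
  "('r, 'b) ring_scheme \<Rightarrow> ('r \<Rightarrow> 'm) \<Rightarrow> ('m, 'r) right_module" where
  "regular_module R h = \<lparr>
     carrier = h ` carrier R,
     mult = (\<lambda>x y. h (inv_into (carrier R) h x \<oplus>\<^bsub>R\<^esub> inv_into (carrier R) h y)),
     one = h \<zero>\<^bsub>R\<^esub>,
     act = (\<lambda>x r. h (inv_into (carrier R) h x \<otimes>\<^bsub>R\<^esub> r))\<rparr>"

lemma right_module_regular_module:
  assumes "ring R" and h: "inj_on h (carrier R)"
  shows "right_module R (regular_module R h)"
proof -
  interpret R: ring R by (rule assms)
  have comm: "comm_group (regular_module R h)"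
  proof (rule comm_groupI)
    fix x assume "x \<in> carrier (regular_module R h)"
    then obtain a where a: "a \<in> carrier R" "x = h a"
      by (auto simp: regular_module_def)
    then show "\<exists>y\<in>carrier (regular_module R h).
        y \<otimes>\<^bsub>regular_module R h\<^esub> x = \<one>\<^bsub>regular_module R h\<^esub>"
      using h by (intro bexI[of _ "h (\<ominus>\<^bsub>R\<^esub> a)"]) (auto simp: regular_module_def R.l_neg)
  qed (use h in \<open>auto simp: regular_module_def R.a_ac\<close>)
  show ?thesis
    by (intro right_module.intro right_module_axioms.intro assms comm)
      (use h in \<open>auto simp: regular_module_def R.l_distr R.r_distr R.m_assoc\<close>)
qed

section \<open>Products and direct sums are isomorphic only over finite index sets\<close>

theorem theorem2p7:
  fixes R :: "('r, 'b) ring_scheme" and I :: "'i set"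
  assumes "ring R"
    and "\<one>\<^bsub>R\<^esub> \<noteq> \<zero>\<^bsub>R\<^esub>"
    and "carrier R \<lesssim> (UNIV :: 'm set)"
  shows "naturally_isomorphic
           (power_category I (right_modules R :: (('m, 'r) right_module, 'm \<Rightarrow> 'm) category))
           (right_modules R :: (('i \<Rightarrow> 'm, 'r) right_module, ('i \<Rightarrow> 'm) \<Rightarrow> ('i \<Rightarrow> 'm)) category)
           (product_functor I) (direct_sum_functor I)
         \<longleftrightarrow> finite I"
proof
  let ?C = "power_category I (right_modules R :: (('m, 'r) right_module, 'm \<Rightarrow> 'm) category)"
  let ?D = "right_modules R :: (('i \<Rightarrow> 'm, 'r) right_module, ('i \<Rightarrow> 'm) \<Rightarrow> ('i \<Rightarrow> 'm)) category"
  assume "naturally_isomorphic ?C ?D (product_functor I) (direct_sum_functor I)"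
  then obtain \<eta>
    where nat: "natural_transformation ?C ?D (product_functor I) (direct_sum_functor I) \<eta>"
      and iso: "\<And>M. M \<in> Ob ?C \<Longrightarrow>
        isomorphism ?D (product_module I M) (direct_sum_module I M) (\<eta> M)"
    by (auto simp: naturally_isomorphic_def)
  interpret R: ring R by (rule assms)
  obtain h :: "'r \<Rightarrow> 'm" where h: "inj_on h (carrier R)"
    using assms(3) by (auto simp: lepoll_def)
  let ?A = "regular_module R h"
  define M where "M = (\<lambda>i\<in>I. ?A)"
  define x where "x = (\<lambda>i\<in>I. h \<one>\<^bsub>R\<^esub>)"
  have mod: "right_module R ?A"
    using right_module_regular_module[OF assms(1) h] .
  have M: "M \<in> Ob ?C"
    using mod by (auto simp: M_def)
  have x: "x \<in> carrier (product_module I M)"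
    by (auto simp: x_def M_def regular_module_def)
  have "h \<one>\<^bsub>R\<^esub> \<noteq> \<one>\<^bsub>?A\<^esub>"
    using assms(2) inj_onD[OF h, of "\<one>\<^bsub>R\<^esub>" "\<zero>\<^bsub>R\<^esub>"] by (auto simp: regular_module_def)
  then have "x j \<noteq> \<one>\<^bsub>M j\<^esub>" if "j \<in> I" for j
    using that by (simp add: x_def M_def)
  then have "\<eta> M x j \<noteq> \<one>\<^bsub>M j\<^esub>" if "j \<in> I" for j
    using natural_mono_preserves_support[OF nat M
        isomorphism_right_modules_inj_on[OF iso[OF M]] x that] that
    by blast
  then have "{i \<in> I. \<eta> M x i \<noteq> \<one>\<^bsub>M i\<^esub>} = I"
    by blast
  moreover have "\<eta> M x \<in> carrier (direct_sum_module I M)"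
    using iso[OF M] linear_mapsD(2)[OF _ x, of "\<eta> M" R]
    by (simp add: isomorphism_def del: product_module_simps)
  moreover have "group (M i)" if "i \<in> I" for i
    using that right_module_group[OF mod] by (simp add: M_def)
  ultimately show "finite I"
    using carrier_direct_sum_module[of I M] by simp
next
  assume "finite I"
  then show "naturally_isomorphic
      (power_category I (right_modules R :: (('m, 'r) right_module, 'm \<Rightarrow> 'm) category))
      (right_modules R :: (('i \<Rightarrow> 'm, 'r) right_module, ('i \<Rightarrow> 'm) \<Rightarrow> ('i \<Rightarrow> 'm)) category)
      (product_functor I) (direct_sum_functor I)"
    by (rule naturally_isomorphic_product_direct_sum_if_finite[OF assms(1)])
qed

end
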